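(* Let $R$ be an integrally closed domain. If $R$ is Boole regular, then $R$ is a Bézout domain of finite character.
   Context: All rings are integral domains (commutative with identity). The class semigroup $S(R)$ of a domain $R$ with quotient field $K$ is the semigroup (under multiplication) of nonzero fractional ideals of $R$ modulo its subsemigroup of nonzero principal fractional ideals (so $I$ and $J$ have the same class iff $I=cJ$ for some $0\ne c\in K$). $R$ is Boole regular if $S(R)$ is a Boolean semigroup, i.e. $x^2=x$ for all $x\in S(R)$; equivalently, for every nonzero fractional ideal $I$ of $R$ there is $0\ne c\in K$ with $I^2=cI$. $R$ is of finite character if each proper nonzero ideal of $R$ is contained in only finitely many maximal ideals of $R$. A Bézout domain is a domain in which every finitely generated ideal is principal. *)

theory Defs
  imports
    "HOL-Computational_Algebra.Fraction_Field"
    "HOL-Computational_Algebra.Polynomial"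
    "HOL-Computational_Algebra.Polynomial_Factorial"
begin

text \<open>
  A domain \<open>R\<close> is a type \<open>'a\<close> of class \<open>idom\<close>, its quotient field is \<open>'a fract\<close>, and
  \<open>to_fract\<close> is the embedding of \<open>R\<close> into it. Properties of \<open>R\<close> as a whole are
  predicates on \<open>'a itself\<close>.
\<close>

text \<open>Ideals are the submodules of \<open>R\<close> over itself, that is, the scalar action is \<open>(*)\<close>.\<close>

lemma module_mult: "module ((*) :: 'a::comm_ring_1 \<Rightarrow> 'a \<Rightarrow> 'a)"
  by unfold_locales (simp_all add: algebra_simps)

definition is_ideal :: "'a::idom set \<Rightarrow> bool"
  where "is_ideal I \<longleftrightarrow> module.subspace (*) I"

definition ideal_gen :: "'a::idom set \<Rightarrow> 'a set"
  where "ideal_gen S = module.span (*) S"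

definition is_maximal_ideal :: "'a::idom set \<Rightarrow> bool"
  where "is_maximal_ideal M \<longleftrightarrow>
    is_ideal M \<and> M \<noteq> UNIV \<and> (\<forall>J. is_ideal J \<longrightarrow> M \<subseteq> J \<longrightarrow> J = M \<or> J = UNIV)"

definition finite_character :: "'a::idom itself \<Rightarrow> bool"
  where "finite_character _ \<longleftrightarrow>
    (\<forall>I :: 'a set. is_ideal I \<longrightarrow> I \<noteq> {0} \<longrightarrow> I \<noteq> UNIV \<longrightarrow>
      finite {M. is_maximal_ideal M \<and> I \<subseteq> M})"

definition bezout_domain :: "'a::idom itself \<Rightarrow> bool"
  where "bezout_domain _ \<longleftrightarrow>
    (\<forall>S :: 'a set. finite S \<longrightarrow> (\<exists>d. ideal_gen S = ideal_gen {d}))"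

definition integrally_closed :: "'a::idom itself \<Rightarrow> bool"
  where "integrally_closed _ \<longleftrightarrow>
    (\<forall>x :: 'a fract.
      (\<exists>p :: 'a poly. lead_coeff p = 1 \<and> poly (map_poly to_fract p) x = 0)
        \<longrightarrow> x \<in> range to_fract)"


definition frac_scale :: "'a::idom \<Rightarrow> 'a fract \<Rightarrow> 'a fract"
  where "frac_scale r x = to_fract r * x"

lemma module_frac_scale: "module (frac_scale :: 'a::idom \<Rightarrow> 'a fract \<Rightarrow> 'a fract)"
  by unfold_locales (simp_all add: frac_scale_def algebra_simps)

definition fractional_ideal :: "'a::idom fract set \<Rightarrow> bool"
  where "fractional_ideal I \<longleftrightarrow>
    module.subspace frac_scale I \<and>
    (\<exists>d :: 'a. d \<noteq> 0 \<and> (\<forall>x\<in>I. to_fract d * x \<in> range to_fract))"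

definition nonzero_fractional_ideals :: "'a::idom fract set set"
  where "nonzero_fractional_ideals = {I. fractional_ideal I \<and> I \<noteq> {0}}"

definition frac_ideal_mult :: "'a::idom fract set \<Rightarrow> 'a fract set \<Rightarrow> 'a fract set"
  where "frac_ideal_mult I J = module.span frac_scale {x * y | x y. x \<in> I \<and> y \<in> J}"

definition same_class :: "('a::idom fract set \<times> 'a fract set) set"
  where "same_class =
    {(I, J). I \<in> nonzero_fractional_ideals \<and> J \<in> nonzero_fractional_ideals \<and>
             (\<exists>c. c \<noteq> 0 \<and> I = (*) c ` J)}"

definition class_semigroup :: "'a::idom fract set set set"
  where "class_semigroup = nonzero_fractional_ideals // same_class"

text \<open>
  The union runs over all pairs of representatives; by \<open>frac_ideal_mult_respects\<close> below all
  its members coincide, so that it is the class of the product of any two representatives.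
\<close>

definition class_mult :: "'a::idom fract set set \<Rightarrow> 'a fract set set \<Rightarrow> 'a fract set set"
  where "class_mult X Y = (\<Union>I\<in>X. \<Union>J\<in>Y. same_class `` {frac_ideal_mult I J})"

definition boole_regular :: "'a::idom itself \<Rightarrow> bool"
  where "boole_regular _ \<longleftrightarrow> (\<forall>X \<in> (class_semigroup :: 'a fract set set set). class_mult X X = X)"


lemma equiv_same_class: "equiv nonzero_fractional_ideals (same_class :: ('a::idom fract set \<times> _) set)"
proof (rule equivI)
  show "(same_class :: ('a fract set \<times> _) set) \<subseteq> nonzero_fractional_ideals \<times> nonzero_fractional_ideals"
    by (auto simp: same_class_def)
  show "refl_on nonzero_fractional_ideals (same_class :: ('a fract set \<times> _) set)"
    by (auto simp: refl_on_def same_class_def intro!: exI[of _ 1])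
  show "sym (same_class :: ('a fract set \<times> _) set)"
  proof (rule symI)
    fix I J :: "'a fract set" assume "(I, J) \<in> same_class"
    then obtain c where c: "I \<in> nonzero_fractional_ideals" "J \<in> nonzero_fractional_ideals"
      "c \<noteq> 0" "I = (*) c ` J" by (auto simp: same_class_def)
    have "J = (*) (inverse c) ` I"
      using c(3) by (simp add: c(4) image_image mult.assoc[symmetric])
    with c show "(J, I) \<in> same_class"
      unfolding same_class_def using nonzero_imp_inverse_nonzero[OF c(3)] by blast
  qed
  show "trans (same_class :: ('a fract set \<times> _) set)"
  proof (rule transI)
    fix I J L :: "'a fract set" assume "(I, J) \<in> same_class" "(J, L) \<in> same_class"
    then obtain c d where c: "I \<in> nonzero_fractional_ideals" "L \<in> nonzero_fractional_ideals"
      "c \<noteq> 0" "I = (*) c ` J" "d \<noteq> 0" "J = (*) d ` L" by (auto simp: same_class_def)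
    have "I = (*) (c * d) ` L" by (simp add: c(4,6) image_image mult.assoc)
    moreover have "c * d \<noteq> 0" using c(3,5) by simp
    ultimately show "(I, L) \<in> same_class"
      unfolding same_class_def using c(1,2) by blast
  qed
qed

lemma fractional_ideal_mult:
  assumes "fractional_ideal I" "fractional_ideal J"
  shows "fractional_ideal (frac_ideal_mult I J)"
proof -
  from assms obtain d e :: 'a
    where d: "d \<noteq> 0" "\<And>x. x \<in> I \<Longrightarrow> to_fract d * x \<in> range to_fract"
      and e: "e \<noteq> 0" "\<And>x. x \<in> J \<Longrightarrow> to_fract e * x \<in> range to_fract"
    unfolding fractional_ideal_def by blast
  have "to_fract (d * e) * z \<in> range to_fract" if "z \<in> frac_ideal_mult I J" for z
    using that unfolding frac_ideal_mult_def
  proof (induction rule: module.span_induct_alt[OF module_frac_scale, consumes 1])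
    case 1
    show ?case using rangeI[of to_fract 0] by simp
  next
    case (2 c x y)
    then obtain u v where uv: "x = u * v" "u \<in> I" "v \<in> J" by blast
    obtain a b w where abw: "to_fract d * u = to_fract a" "to_fract e * v = to_fract b"
      "to_fract (d * e) * y = to_fract w"
      using d(2)[OF uv(2)] e(2)[OF uv(3)] 2 by blast
    have "to_fract (d * e) * (frac_scale c x + y)
        = to_fract c * (to_fract d * u) * (to_fract e * v) + to_fract (d * e) * y"
      by (simp add: uv frac_scale_def algebra_simps)
    also have "\<dots> = to_fract (c * a * b + w)" using abw(3) by (simp add: abw(1,2))
    finally show ?case by blast
  qed
  moreover have "d * e \<noteq> 0" using d e by simp
  moreover have "module.subspace frac_scale (frac_ideal_mult I J)"
    unfolding frac_ideal_mult_def by (rule module.subspace_span[OF module_frac_scale])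
  ultimately show ?thesis
    unfolding fractional_ideal_def by blast
qed

lemma nonzero_fractional_ideals_mult:
  assumes "I \<in> nonzero_fractional_ideals" "J \<in> nonzero_fractional_ideals"
  shows "frac_ideal_mult I J \<in> nonzero_fractional_ideals"
proof -
  have nz: "\<exists>x\<in>L. x \<noteq> 0" if "L \<in> nonzero_fractional_ideals" for L :: "'a fract set"
    using that module.subspace_0[OF module_frac_scale, of L]
    by (auto simp: nonzero_fractional_ideals_def fractional_ideal_def)
  obtain x y where xy: "x \<in> I" "y \<in> J" "x \<noteq> 0" "y \<noteq> 0" using nz assms by blast
  have "x * y \<in> frac_ideal_mult I J"
    unfolding frac_ideal_mult_def
    by (rule module.span_base[OF module_frac_scale]) (use xy in blast)
  moreover have "x * y \<noteq> 0" using xy by simp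
  ultimately show ?thesis
    using assms fractional_ideal_mult by (auto simp: nonzero_fractional_ideals_def)
qed

lemma frac_ideal_mult_scaled:
  "frac_ideal_mult ((*) c ` I) ((*) d ` J) = (*) (c * d) ` frac_ideal_mult I J"
proof -
  have hom: "module_hom frac_scale frac_scale ((*) (c * d))"
    by (intro module_hom.intro module_hom_axioms.intro module_frac_scale)
       (simp_all add: frac_scale_def algebra_simps)
  have eq: "(c * u) * (d * v) = (c * d) * (u * v)" for u v
    by (simp add: algebra_simps)
  have "{x * y |x y. x \<in> (*) c ` I \<and> y \<in> (*) d ` J} = {(c * u) * (d * v) |u v. u \<in> I \<and> v \<in> J}"
    by blast
  also have "\<dots> = {(c * d) * (u * v) |u v. u \<in> I \<and> v \<in> J}"
    by (simp only: eq)
  also have "\<dots> = (*) (c * d) ` {x * y |x y. x \<in> I \<and> y \<in> J}"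
    by blast
  finally have "{x * y |x y. x \<in> (*) c ` I \<and> y \<in> (*) d ` J} =
    (*) (c * d) ` {x * y |x y. x \<in> I \<and> y \<in> J}" .
  then show ?thesis
    unfolding frac_ideal_mult_def by (simp add: module_hom.span_image[OF hom])
qed

lemma frac_ideal_mult_respects:
  assumes "(I, I') \<in> same_class" "(J, J') \<in> same_class"
  shows "(frac_ideal_mult I J, frac_ideal_mult I' J') \<in> same_class"
proof -
  from assms obtain c d where "c \<noteq> 0" "d \<noteq> 0" and eqs: "I = (*) c ` I'" "J = (*) d ` J'"
    by (auto simp: same_class_def)
  then have "c * d \<noteq> 0 \<and> frac_ideal_mult I J = (*) (c * d) ` frac_ideal_mult I' J'"
    by (simp add: frac_ideal_mult_scaled)
  with assms show ?thesis
    unfolding same_class_def by (blast intro: nonzero_fractional_ideals_mult)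
qed

lemma class_mult_class:
  assumes "I \<in> nonzero_fractional_ideals" "J \<in> nonzero_fractional_ideals"
  shows "class_mult (same_class `` {I}) (same_class `` {J}) = same_class `` {frac_ideal_mult I J}"
proof -
  have "same_class `` {frac_ideal_mult I' J'} = same_class `` {frac_ideal_mult I J}"
    if "I' \<in> same_class `` {I}" "J' \<in> same_class `` {J}" for I' J'
    using that frac_ideal_mult_respects[of I I' J J'] equiv_class_eq[OF equiv_same_class] by blast
  moreover have "I \<in> same_class `` {I}" "J \<in> same_class `` {J}"
    using equiv_class_self[OF equiv_same_class] assms by auto
  ultimately show ?thesis unfolding class_mult_def by blast
qed

lemma boole_regular_iff:
  "boole_regular TYPE('a::idom) \<longleftrightarrow>
    (\<forall>I \<in> (nonzero_fractional_ideals :: 'a fract set set).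
      \<exists>c. c \<noteq> 0 \<and> frac_ideal_mult I I = (*) c ` I)"
proof -
  have "class_mult (same_class `` {I}) (same_class `` {I}) = same_class `` {I} \<longleftrightarrow>
      (\<exists>c. c \<noteq> 0 \<and> frac_ideal_mult I I = (*) c ` I)"
    if I: "I \<in> nonzero_fractional_ideals" for I :: "'a fract set"
    using I nonzero_fractional_ideals_mult[OF I I]
    by (simp add: class_mult_class eq_equiv_class_iff[OF equiv_same_class])
       (simp add: same_class_def)
  then show ?thesis
    unfolding boole_regular_def class_semigroup_def quotient_def by auto
qed

end

theory Submission
  imports Defs
begin

text \<open>
  If \<open>I\<^sup>2 = cI\<close>, then \<open>J = c\<^sup>-\<^sup>1I\<close> is idempotent, so Boole regularity says that every nonzero
  fractional ideal is a multiple of an idempotent one. The proof plays this against ideals \<open>I\<close>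
  whose only possible idempotent multiple is \<open>R\<close> itself, which forces \<open>I\<close> to be principal.

  For the Bezout property (\<open>boole_regular_imp_bezout\<close>) take \<open>I\<close> generated by \<open>a\<close> and \<open>b\<close>. Each
  element of \<open>J\<close> maps the finitely generated module \<open>J\<close> into \<open>J\<^sup>2 = J\<close>, hence is integral over
  \<open>R\<close> by the determinant trick, so \<open>J \<subseteq> R\<close> because \<open>R\<close> is integrally closed. The
  determinant trick, applied once more to \<open>J = J\<^sup>2\<close>, gives \<open>1 \<in> J\<close>. So \<open>J = R\<close> and \<open>I = cR\<close>.

  For finite character, suppose that \<open>x \<noteq> 0\<close> lies in infinitely many maximal ideals. In a Bezout
  domain \<open>x\<close> then has an infinite sequence of pairwise comaximal nonunit divisors
  \<open>b\<^sub>0, b\<^sub>1, \<dots>\<close> (\<open>comaximal_sequence_of_divisors\<close>). With \<open>p\<^sub>n = b\<^sub>0 \<cdots> b\<^sub>n\<^sub>-\<^sub>1\<close>, which divides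
  \<open>x\<close>, the union \<open>I\<close> of the chain \<open>R p\<^sub>n\<^sup>-\<^sup>1\<close> is a fractional ideal. A maximal ideal contains at
  most one \<open>b\<^sub>i\<close>, so the chain becomes stationary in every localization at a maximal ideal: \<open>I\<close>
  is locally principal, and so is \<open>J\<close>. An idempotent locally principal ideal is \<open>R\<close>, hence \<open>I\<close>
  would be principal and the chain stationary, although no \<open>b\<^sub>i\<close> is a unit
  (\<open>boole_regular_no_comaximal_sequence\<close>, where comaximality replaces the localizations).
\<close>

section \<open>Ideals and comaximal elements\<close>

lemma is_ideal_iff:
  "is_ideal I \<longleftrightarrow> 0 \<in> I \<and> (\<forall>x\<in>I. \<forall>y\<in>I. x + y \<in> I) \<and> (\<forall>r. \<forall>x\<in>I. r * x \<in> I)"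
  by (auto simp: is_ideal_def module.subspace_def[OF module_mult])

lemma ideal_gen_pair: "ideal_gen {a, b} = {r * a + s * b | r s. True}"
proof -
  have "x \<in> ideal_gen {a, b} \<longleftrightarrow> (\<exists>r s. x = r * a + s * b)" for x
    by (auto simp: ideal_gen_def module.span_breakdown_eq[OF module_mult]
        module.span_empty[OF module_mult] algebra_simps)
  then show ?thesis by auto
qed

lemma ideal_gen_single: "ideal_gen {a} = {r * a | r. True}"
  using ideal_gen_pair[of a a] by (auto simp: distrib_right[symmetric]) (metis add_0_right)

text \<open>Two generators suffice, since generators can be merged one at a time.\<close>

lemma bezout_domain_iff:
  "bezout_domain TYPE('a::idom) \<longleftrightarrow>
    (\<forall>a b :: 'a. \<exists>d r s. d = r * a + s * b \<and> d dvd a \<and> d dvd b)"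
proof
  assume bez: "bezout_domain TYPE('a)"
  show "\<forall>a b :: 'a. \<exists>d r s. d = r * a + s * b \<and> d dvd a \<and> d dvd b"
  proof (intro allI)
    fix a b :: 'a
    obtain d where d: "ideal_gen {a, b} = ideal_gen {d}"
      using bez[unfolded bezout_domain_def, rule_format, of "{a, b}"] by auto
    have "d \<in> ideal_gen {d}" "a \<in> ideal_gen {a, b}" "b \<in> ideal_gen {a, b}"
      by (auto simp: ideal_gen_def module.span_base[OF module_mult])
    then have "d \<in> ideal_gen {a, b}" "a \<in> ideal_gen {d}" "b \<in> ideal_gen {d}"
      by (simp_all add: d)
    then have "\<exists>r s. d = r * a + s * b" "d dvd a" "d dvd b"
      unfolding ideal_gen_pair ideal_gen_single by auto
    then show "\<exists>d r s. d = r * a + s * b \<and> d dvd a \<and> d dvd b" by blast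
  qed
next
  assume gcds: "\<forall>a b :: 'a. \<exists>d r s. d = r * a + s * b \<and> d dvd a \<and> d dvd b"
  have "\<exists>d. ideal_gen S = ideal_gen {d}" if "finite S" for S :: "'a set"
    using that
  proof (induction S)
    case empty
    show ?case
      by (rule exI[of _ 0]) (auto simp: ideal_gen_single,
        auto simp: ideal_gen_def module.span_empty[OF module_mult])
  next
    case (insert a S)
    then obtain e where e: "ideal_gen S = ideal_gen {e}" by blast
    have ins: "ideal_gen (insert a S) = ideal_gen {a, e}"
      using e by (simp add: ideal_gen_def module.span_insert[OF module_mult])
    obtain d r s where d: "d = r * a + s * e" "d dvd a" "d dvd e"
      using gcds by blast
    obtain a' e' where "a = d * a'" "e = d * e'"
      using d(2,3) by (auto simp: dvd_def)
    then have "u * a + v * e = (u * a' + v * e') * d" for u v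
      by (simp add: algebra_simps)
    moreover have "t * d = (t * r) * a + (t * s) * e" for t
      unfolding d(1) by (simp add: algebra_simps)
    ultimately have "ideal_gen {a, e} = ideal_gen {d}"
      unfolding ideal_gen_pair ideal_gen_single by blast
    with ins show ?case by blast
  qed
  then show "bezout_domain TYPE('a)" by (simp add: bezout_domain_def)
qed

definition comaximal :: "'a::idom \<Rightarrow> 'a \<Rightarrow> bool"
  where "comaximal a b \<longleftrightarrow> (\<exists>r s. r * a + s * b = 1)"

lemma comaximal_commute: "comaximal a b \<longleftrightarrow> comaximal b a"
  unfolding comaximal_def by (metis add.commute)

lemma comaximal_dvd_right:
  assumes "comaximal a b" "c dvd b" shows "comaximal a c"
proof -
  obtain r s e where "r * a + s * b = 1" "b = c * e"
    using assms by (auto simp: comaximal_def dvd_def)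
  then have "r * a + (s * e) * c = 1" by (simp add: algebra_simps)
  then show ?thesis unfolding comaximal_def by blast
qed

lemma comaximal_mult_right:
  assumes "comaximal a b" "comaximal a c" shows "comaximal a (b * c)"
proof -
  obtain r s t u where "r * a + s * b = 1" "t * a + u * c = 1"
    using assms by (auto simp: comaximal_def)
  then have "(r * a + s * b) * (t * a + u * c) = 1" by simp
  then have "(r * (t * a + u * c) + s * b * t) * a + (s * u) * (b * c) = 1"
    by (simp add: algebra_simps)
  then show ?thesis unfolding comaximal_def by blast
qed

lemma comaximal_prod_right:
  assumes "\<And>i. i \<in> A \<Longrightarrow> comaximal a (f i)" shows "comaximal a (prod f A)"
  using assms
proof (induction A rule: infinite_finite_induct)
  case (insert x A)
  then show ?case by (simp add: comaximal_mult_right)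
next
  case (infinite A)
  have "0 * a + 1 * 1 = 1" by simp
  then show ?case using infinite(1) unfolding comaximal_def by (metis prod.infinite)
next
  case empty
  have "0 * a + 1 * 1 = 1" by simp
  then show ?case unfolding comaximal_def by (metis prod.empty)
qed

lemma comaximal_mult_dvd:
  assumes "comaximal a b" "a dvd x" "b dvd x" shows "a * b dvd x"
proof -
  obtain r s where rs: "r * a + s * b = 1" using assms(1) by (auto simp: comaximal_def)
  obtain a' b' where "x = a * a'" "x = b * b'" using assms(2,3) unfolding dvd_def by blast
  have "x = (r * a + s * b) * x" by (simp add: rs)
  also have "\<dots> = r * a * (b * b') + s * b * (a * a')"
    using \<open>x = a * a'\<close> \<open>x = b * b'\<close> by (metis distrib_right)
  also have "\<dots> = (a * b) * (r * b' + s * a')" by (simp add: algebra_simps)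
  finally show ?thesis by (metis dvd_triv_left)
qed

lemma comaximal_common_divisor:
  assumes "comaximal a b" "d dvd a" "d dvd b" shows "d dvd 1"
  using assms unfolding comaximal_def by (metis dvd_add dvd_mult)


section \<open>Maximal ideals\<close>

lemma proper_ideal_subset_maximal:
  assumes I: "is_ideal I" "1 \<notin> I"
  obtains M where "is_maximal_ideal M" "I \<subseteq> M"
proof -
  define \<A> where "\<A> = {J. is_ideal J \<and> I \<subseteq> J \<and> 1 \<notin> J}"
  have "\<exists>M\<in>\<A>. \<forall>X\<in>\<A>. M \<subseteq> X \<longrightarrow> X = M"
  proof (rule subset_Zorn_nonempty)
    show "\<A> \<noteq> {}" using I by (auto simp: \<A>_def)
  next
    fix \<C> assume ne: "\<C> \<noteq> {}" and ch: "subset.chain \<A> \<C>"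
    have mem: "is_ideal J" "I \<subseteq> J" "1 \<notin> J" if "J \<in> \<C>" for J
      using ch that by (auto simp: subset.chain_def \<A>_def)
    have "x + y \<in> \<Union>\<C>" if xy: "x \<in> X" "X \<in> \<C>" "y \<in> Y" "Y \<in> \<C>" for x y X Y
    proof -
      have "X \<subseteq> Y \<or> Y \<subseteq> X" using ch xy by (auto simp: subset.chain_def)
      with xy mem(1) show ?thesis unfolding is_ideal_iff by blast
    qed
    moreover have "r * x \<in> \<Union>\<C>" if "x \<in> X" "X \<in> \<C>" for r x X
      using mem(1)[of X] that unfolding is_ideal_iff by blast
    moreover have "0 \<in> \<Union>\<C>" using ne mem(1) by (auto simp: is_ideal_iff)
    ultimately have "is_ideal (\<Union>\<C>)" by (auto simp: is_ideal_iff)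
    moreover have "I \<subseteq> \<Union>\<C>" using ne mem(2) by blast
    ultimately show "\<Union>\<C> \<in> \<A>" using mem(3) by (auto simp: \<A>_def)
  qed
  then obtain M where M: "M \<in> \<A>" "\<And>X. X \<in> \<A> \<Longrightarrow> M \<subseteq> X \<Longrightarrow> X = M" by blast
  have "J = M \<or> J = UNIV" if J: "is_ideal J" "M \<subseteq> J" for J
  proof (cases "1 \<in> J")
    case True
    then have "x \<in> J" for x using J(1) unfolding is_ideal_iff by (metis mult.right_neutral)
    then show ?thesis by blast
  next
    case False
    then show ?thesis using M J by (auto simp: \<A>_def)
  qed
  then have "is_maximal_ideal M"
    using M(1) by (auto simp: is_maximal_ideal_def \<A>_def)
  then show ?thesis using M(1) that by (auto simp: \<A>_def)
qed

lemma maximal_ideal_nonunit: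
  assumes "is_maximal_ideal M" "x \<in> M" shows "\<not> x dvd 1"
proof
  assume "x dvd 1"
  then obtain y where y: "1 = y * x" by (auto simp: dvd_def mult.commute)
  have "z = (z * y) * x" for z by (simp add: mult.assoc y[symmetric])
  then have "z \<in> M" for z
    using assms unfolding is_maximal_ideal_def is_ideal_iff by metis
  then show False using assms(1) by (auto simp: is_maximal_ideal_def)
qed

lemma nonunit_in_maximal_ideal:
  assumes "\<not> x dvd 1"
  obtains M where "is_maximal_ideal M" "x \<in> M"
proof -
  have "\<exists>t. r * x + s * x = t * x" "\<exists>t. r * (s * x) = t * x" "\<exists>t. 0 = t * x" for r s
    by (metis distrib_right, metis mult.assoc, metis mult_zero_left)
  then have "is_ideal {r * x | r. True}" unfolding is_ideal_iff by blast
  moreover have "1 \<notin> {r * x | r. True}"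
    using assms by (auto simp: dvd_def mult.commute)
  ultimately obtain M where "is_maximal_ideal M" "{r * x | r. True} \<subseteq> M"
    using proper_ideal_subset_maximal by blast
  moreover have "x \<in> {r * x | r. True}" using mult_1[of x, symmetric] by blast
  ultimately show ?thesis using that by blast
qed

lemma maximal_ideal_closed:
  assumes "is_maximal_ideal M"
  shows "x \<in> M \<Longrightarrow> y \<in> M \<Longrightarrow> x + y \<in> M" "x \<in> M \<Longrightarrow> r * x \<in> M" "x \<in> M \<Longrightarrow> x dvd y \<Longrightarrow> y \<in> M"
proof -
  have add: "\<forall>x\<in>M. \<forall>y\<in>M. x + y \<in> M" and mult: "\<forall>r. \<forall>x\<in>M. r * x \<in> M"
    using assms by (simp_all add: is_maximal_ideal_def is_ideal_iff)
  show "x \<in> M \<Longrightarrow> y \<in> M \<Longrightarrow> x + y \<in> M" "x \<in> M \<Longrightarrow> r * x \<in> M"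
    using add mult by blast+
  show "y \<in> M" if "x \<in> M" "x dvd y"
    using that mult by (metis dvdE mult.commute)
qed

lemma maximal_ideals_comaximal:
  assumes M: "is_maximal_ideal M" and N: "is_maximal_ideal N" and "M \<noteq> N"
  shows "\<exists>a\<in>M. 1 - a \<in> N"
proof -
  \<comment> \<open>The sum \<open>M + N\<close> properly contains one of the two, so it is the whole ring.\<close>
  define J where "J = {a + b | a b. a \<in> M \<and> b \<in> N}"
  have z: "0 \<in> M" "0 \<in> N"
    using M N by (auto simp: is_maximal_ideal_def is_ideal_iff)
  have "is_ideal J"
    unfolding is_ideal_iff
  proof (intro conjI ballI allI)
    show "0 \<in> J" using z by (auto simp: J_def intro!: exI[of _ 0])
  next
    fix x y assume "x \<in> J" "y \<in> J"
    then obtain a b a' b' where "x = a + b" "y = a' + b'" "a \<in> M" "a' \<in> M" "b \<in> N" "b' \<in> N"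
      by (auto simp: J_def)
    then have "x + y = (a + a') + (b + b')" "a + a' \<in> M" "b + b' \<in> N"
      using maximal_ideal_closed[OF M] maximal_ideal_closed[OF N] by (auto simp: algebra_simps)
    then show "x + y \<in> J" by (auto simp: J_def)
  next
    fix r x assume "x \<in> J"
    then show "r * x \<in> J"
      using maximal_ideal_closed(2)[OF M] maximal_ideal_closed(2)[OF N]
      unfolding J_def by (auto simp: distrib_left) blast
  qed
  moreover have "M \<subseteq> J" "N \<subseteq> J" using z unfolding J_def by force+
  ultimately have "J = UNIV"
    using M N \<open>M \<noteq> N\<close> unfolding is_maximal_ideal_def by blast
  then have "1 \<in> J" by simp
  then obtain a b where "1 = a + b" "a \<in> M" "b \<in> N" by (auto simp: J_def)
  then have "1 - a = b" by (metis add_diff_cancel_left')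
  with \<open>a \<in> M\<close> \<open>b \<in> N\<close> show ?thesis by blast
qed

text \<open>
  An element of \<open>M\<close> that avoids every member of \<open>F\<close> is found by the Chinese remainder theorem, as
  one that is congruent to \<open>1\<close> modulo each of them.
\<close>

lemma maximal_ideal_avoidance:
  assumes M: "is_maximal_ideal M" and "finite F" "M \<notin> F" "\<And>N. N \<in> F \<Longrightarrow> is_maximal_ideal N"
  shows "\<exists>m\<in>M. \<forall>N\<in>F. 1 - m \<in> N"
  using assms(2-)
proof (induction F)
  case empty
  then show ?case using M by (auto simp: is_maximal_ideal_def is_ideal_iff)
next
  case (insert N F)
  then obtain m where m: "m \<in> M" "\<And>N. N \<in> F \<Longrightarrow> 1 - m \<in> N" by auto
  obtain a where a: "a \<in> M" "1 - a \<in> N"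
    using maximal_ideals_comaximal[OF M, of N] insert.prems by auto
  \<comment> \<open>The new element is one minus the product of \<open>1 - m\<close> and \<open>1 - a\<close>.\<close>
  have eq: "1 - (m + (1 - m) * a) = (1 - m) * (1 - a)"
    "(1 - m) * (1 - a) = (1 - a) * (1 - m)" by (simp_all add: algebra_simps)
  have "1 - (m + (1 - m) * a) \<in> L" if "L \<in> insert N F" for L
    using that maximal_ideal_closed(2)[OF insert.prems(2)[OF that]] m(2) a(2) eq
    by (metis insertE)
  moreover have "m + (1 - m) * a \<in> M" using maximal_ideal_closed[OF M] m(1) a(1) by blast
  ultimately show ?case by blast
qed

section \<open>Infinitely many maximal ideals yield infinitely many comaximal divisors\<close>

lemma bezout_gcd:
  assumes "bezout_domain TYPE('a::idom)"
  obtains d r s where "d = r * a + s * b" "d dvd a" "d dvd (b :: 'a)"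
  using assms unfolding bezout_domain_iff by blast

lemma gcd_in_maximal_ideal:
  assumes "bezout_domain TYPE('a::idom)" "is_maximal_ideal M" "a \<in> M" "(b :: 'a) \<in> M"
  obtains d where "d dvd a" "d dvd b" "d \<in> M"
  using bezout_gcd[OF assms(1), of a b] maximal_ideal_closed[OF assms(2)] assms(3,4) by metis

text \<open>
  If \<open>y\<close> lies in distinct maximal ideals \<open>M\<close> and \<open>N\<close>, write \<open>1 = a + (1 - a)\<close> with \<open>a \<in> M\<close> and
  \<open>1 - a \<in> N\<close>; the greatest common divisors of \<open>y\<close> with the two summands are the required factors.
\<close>

lemma split_nonunit:
  assumes bez: "bezout_domain TYPE('a::idom)" and "\<not> (y :: 'a) dvd 1"
    and "\<not> (\<exists>N. {M. is_maximal_ideal M \<and> y \<in> M} = {N})"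
  obtains u v where "u dvd y" "v dvd y" "\<not> u dvd 1" "\<not> v dvd 1" "comaximal u v"
proof -
  obtain M where M: "is_maximal_ideal M" "y \<in> M"
    using nonunit_in_maximal_ideal assms(2) by blast
  then have "\<exists>N. is_maximal_ideal N \<and> y \<in> N \<and> M \<noteq> N" using assms(3) by blast
  then obtain N where N: "is_maximal_ideal N" "y \<in> N" "M \<noteq> N" by blast
  obtain a where a: "a \<in> M" "1 - a \<in> N"
    using maximal_ideals_comaximal M(1) N(1,3) by blast
  obtain u where u: "u dvd y" "u dvd a" "u \<in> M"
    using gcd_in_maximal_ideal[OF bez M a(1)] by blast
  obtain v where v: "v dvd y" "v dvd 1 - a" "v \<in> N"
    using gcd_in_maximal_ideal[OF bez N(1,2) a(2)] by blast
  have "comaximal a (1 - a)"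
    unfolding comaximal_def by (intro exI[of _ 1]) simp
  then have "comaximal u v"
    using u(2) v(2) by (meson comaximal_commute comaximal_dvd_right)
  then show ?thesis
    using that u v maximal_ideal_nonunit M(1) N(1) by blast
qed

text \<open>
  Split \<open>y\<close> into comaximal \<open>u\<^sub>0\<close> and \<open>v\<^sub>0\<close>, then \<open>v\<^sub>0\<close> into \<open>u\<^sub>1\<close> and \<open>v\<^sub>1\<close>, and so on. Each later
  \<open>u\<^sub>j\<close> divides \<open>v\<^sub>i\<close>, so it is comaximal with \<open>u\<^sub>i\<close>.
\<close>

lemma comaximal_sequence_by_splitting:
  assumes bez: "bezout_domain TYPE('a::idom)" and y: "\<not> (y :: 'a) dvd 1"
    and split: "\<And>z. z dvd y \<Longrightarrow> \<not> z dvd 1 \<Longrightarrow> \<not> (\<exists>N. {M. is_maximal_ideal M \<and> z \<in> M} = {N})"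
  shows "\<exists>b :: nat \<Rightarrow> 'a. (\<forall>i. b i dvd y \<and> \<not> b i dvd 1) \<and> (\<forall>i j. i < j \<longrightarrow> comaximal (b i) (b j))"
proof -
  let ?P = "\<lambda>p :: 'a \<times> 'a. comaximal (fst p) (snd p) \<and> fst p dvd y \<and> snd p dvd y
      \<and> \<not> fst p dvd 1 \<and> \<not> snd p dvd 1"
  have step: "\<exists>p. ?P p \<and> fst p dvd z \<and> snd p dvd z" if z: "z dvd y" "\<not> z dvd 1" for z
  proof -
    obtain u v where "u dvd z" "v dvd z" "\<not> u dvd 1" "\<not> v dvd 1" "comaximal u v"
      using split_nonunit[OF bez z(2) split[OF z]] by blast
    with z(1) show ?thesis by (intro exI[of _ "(u, v)"]) (auto intro: dvd_trans)
  qed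
  have "\<exists>f. \<forall>n. ?P (f n) \<and> (fst (f (Suc n)) dvd snd (f n) \<and> snd (f (Suc n)) dvd snd (f n))"
    using step[OF dvd_refl y] step by (intro dependent_nat_choice) blast+
  then obtain f where P: "\<And>n. ?P (f n)"
    and f: "\<And>n. fst (f (Suc n)) dvd snd (f n)" "\<And>n. snd (f (Suc n)) dvd snd (f n)" by blast
  have anti: "snd (f j) dvd snd (f i)" if "i \<le> j" for i j
    using that by (induction rule: dec_induct) (auto intro: dvd_trans f(2))
  have "comaximal (fst (f i)) (fst (f j))" if ij: "i < j" for i j
  proof -
    define k where "k = j - 1"
    have k: "j = Suc k" "i \<le> k" using ij by (auto simp: k_def)
    have "fst (f j) dvd snd (f i)" using f(1)[of k] anti[OF k(2)] k(1) dvd_trans by blast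
    with P[of i] show ?thesis using comaximal_dvd_right by blast
  qed
  with P show ?thesis by (intro exI[of _ "\<lambda>i. fst (f i)"]) blast
qed

lemma comaximal_if_distinct_unique_maximal_ideals:
  assumes bez: "bezout_domain TYPE('a::idom)"
    and "{L. is_maximal_ideal L \<and> (g :: 'a) \<in> L} = {M}" "{L. is_maximal_ideal L \<and> h \<in> L} = {N}"
    and "M \<noteq> N"
  shows "comaximal g h"
proof -
  obtain d r s where d: "d = r * g + s * h" "d dvd g" "d dvd h" using bezout_gcd[OF bez] .
  have "d dvd 1"
  proof (rule ccontr)
    assume "\<not> d dvd 1"
    then obtain L where "is_maximal_ideal L" "d \<in> L" using nonunit_in_maximal_ideal by blast
    then have "g \<in> L" "h \<in> L" using d(2,3) maximal_ideal_closed(3) by blast+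
    with \<open>is_maximal_ideal L\<close> assms(2-) show False by blast
  qed
  then obtain e where "1 = d * e" by (auto simp: dvd_def)
  then have "(e * r) * g + (e * s) * h = 1" by (simp add: d(1) algebra_simps)
  then show ?thesis unfolding comaximal_def by blast
qed

text \<open>
  Either some divisor of \<open>x\<close> can be split forever, or every nonunit divisor of \<open>x\<close> has a divisor
  lying in exactly one maximal ideal. In the second case let \<open>\<N>\<close> be the set of the maximal ideals
  singled out in this way by divisors of \<open>x\<close>. Divisors that single out different members are
  comaximal, so it is enough that \<open>\<N>\<close> is infinite. If it were finite, a maximal ideal \<open>M\<close> that
  contains \<open>x\<close> but is not in \<open>\<N>\<close> would contain an element \<open>m\<close> avoiding all of \<open>\<N>\<close>; a common
  divisor in \<open>M\<close> of \<open>x\<close> and \<open>m\<close> would again single out a member of \<open>\<N>\<close>, which then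
  contains \<open>m\<close>. So \<open>\<N>\<close> would contain all of the infinitely many maximal ideals around \<open>x\<close>.
\<close>

lemma comaximal_sequence_of_divisors:
  assumes bez: "bezout_domain TYPE('a::idom)"
    and inf: "infinite {M. is_maximal_ideal M \<and> (x :: 'a) \<in> M}"
  shows "\<exists>b :: nat \<Rightarrow> 'a. (\<forall>i. b i dvd x \<and> \<not> b i dvd 1) \<and> (\<forall>i j. i < j \<longrightarrow> comaximal (b i) (b j))"
proof (cases "\<exists>y. y dvd x \<and> \<not> y dvd 1 \<and>
    (\<forall>z. z dvd y \<longrightarrow> \<not> z dvd 1 \<longrightarrow> \<not> (\<exists>N. {M. is_maximal_ideal M \<and> z \<in> M} = {N}))")
  case True
  then obtain y where y: "y dvd x" "\<not> y dvd 1"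
    and split: "\<And>z. z dvd y \<Longrightarrow> \<not> z dvd 1 \<Longrightarrow> \<not> (\<exists>N. {M. is_maximal_ideal M \<and> z \<in> M} = {N})" by blast
  obtain b :: "nat \<Rightarrow> 'a" where b: "\<And>i. b i dvd y" "\<And>i. \<not> b i dvd 1"
      "\<And>i j. i < j \<Longrightarrow> comaximal (b i) (b j)"
    using comaximal_sequence_by_splitting[OF bez y(2) split] by blast
  have "b i dvd x" for i by (rule dvd_trans[OF b(1) y(1)])
  with b(2,3) show ?thesis by (intro exI[of _ b]) simp
next
  case False
  then have unique: "\<exists>h N. h dvd y \<and> {M. is_maximal_ideal M \<and> h \<in> M} = {N}"
    if "y dvd x" "\<not> y dvd 1" for y
    using that by metis
  define \<N> where "\<N> = {N. \<exists>h. h dvd x \<and> {M. is_maximal_ideal M \<and> h \<in> M} = {N}}"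
  have max: "is_maximal_ideal N" if "N \<in> \<N>" for N
    using that unfolding \<N>_def by blast
  have "infinite \<N>"
  proof
    assume fin: "finite \<N>"
    have "M \<in> \<N>" if M: "is_maximal_ideal M" "x \<in> M" for M
    proof (rule ccontr)
      assume "M \<notin> \<N>"
      then obtain m where m: "m \<in> M" "\<And>N. N \<in> \<N> \<Longrightarrow> 1 - m \<in> N"
        using maximal_ideal_avoidance[OF M(1) fin] max by blast
      obtain d where d: "d dvd x" "d dvd m" "d \<in> M"
        using gcd_in_maximal_ideal[OF bez M m(1)] .
      have "\<not> d dvd 1" by (rule maximal_ideal_nonunit[OF M(1) d(3)])
      then obtain h N where h: "h dvd d" "{M. is_maximal_ideal M \<and> h \<in> M} = {N}"
        using unique[OF d(1)] by blast
      then have "N \<in> \<N>" unfolding \<N>_def using dvd_trans[OF h(1) d(1)] by blast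
      have N: "is_maximal_ideal N" "h \<in> N" using h(2) by blast+
      have "m \<in> N" by (rule maximal_ideal_closed(3)[OF N dvd_trans[OF h(1) d(2)]])
      then have "1 \<in> N"
        using maximal_ideal_closed(1)[OF N(1), of m "1 - m"] m(2)[OF \<open>N \<in> \<N>\<close>] by simp
      then show False using maximal_ideal_nonunit[OF N(1)] dvd_refl by metis
    qed
    then have "{M. is_maximal_ideal M \<and> x \<in> M} \<subseteq> \<N>" by (intro subsetI) simp
    then show False using inf finite_subset[OF _ fin] by metis
  qed
  then obtain N :: "nat \<Rightarrow> 'a set" where N: "inj N" "range N \<subseteq> \<N>"
    using infinite_countable_subset[OF \<open>infinite \<N>\<close>] by auto
  then have "N i \<in> \<N>" for i by auto
  then have "\<forall>i. \<exists>h. h dvd x \<and> {M. is_maximal_ideal M \<and> h \<in> M} = {N i}"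
    unfolding \<N>_def mem_Collect_eq ..
  then obtain b where b: "\<And>i. b i dvd x" "\<And>i. {M. is_maximal_ideal M \<and> b i \<in> M} = {N i}"
    by metis
  have "\<not> b i dvd 1" for i
    using b(2)[of i] maximal_ideal_nonunit[of "N i" "b i"] by blast
  moreover have "comaximal (b i) (b j)" if "i < j" for i j
    using that injD[OF N(1), of i j]
    by (intro comaximal_if_distinct_unique_maximal_ideals[OF bez b(2) b(2)]) auto
  ultimately show ?thesis using b(1) by (intro exI[of _ b]) simp
qed

section \<open>Boole regular domains that are integrally closed are Bezout\<close>

lemma frac_subspace_iff:
  "module.subspace frac_scale I \<longleftrightarrow>
    0 \<in> I \<and> (\<forall>x\<in>I. \<forall>y\<in>I. x + y \<in> I) \<and> (\<forall>r. \<forall>x\<in>I. to_fract r * x \<in> I)"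
  by (auto simp: module.subspace_def[OF module_frac_scale] frac_scale_def)

lemma frac_ideal_mult_memI: "x \<in> I \<Longrightarrow> y \<in> J \<Longrightarrow> x * y \<in> frac_ideal_mult I J"
  unfolding frac_ideal_mult_def by (rule module.span_base[OF module_frac_scale]) blast

lemma frac_ideal_mult_least:
  assumes "module.subspace frac_scale L" "\<And>x y. x \<in> I \<Longrightarrow> y \<in> J \<Longrightarrow> x * y \<in> L"
  shows "frac_ideal_mult I J \<subseteq> L"
  unfolding frac_ideal_mult_def
  by (rule module.span_minimal[OF module_frac_scale]) (use assms in auto)

lemma boole_regularE:
  assumes "boole_regular TYPE('a::idom)" "(I :: 'a fract set) \<in> nonzero_fractional_ideals"
  obtains c where "c \<noteq> 0" "\<And>x y. x \<in> I \<Longrightarrow> y \<in> I \<Longrightarrow> x * y / c \<in> I"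
    "\<And>x. x \<in> I \<Longrightarrow> c * x \<in> frac_ideal_mult I I"
proof -
  obtain c where c: "c \<noteq> 0" "frac_ideal_mult I I = (*) c ` I"
    using assms unfolding boole_regular_iff by blast
  have "x * y / c \<in> I" if "x \<in> I" "y \<in> I" for x y
    using frac_ideal_mult_memI[OF that] c by auto
  then show ?thesis using that c by blast
qed

text \<open>
  An eigenvalue of a two by two matrix over \<open>R\<close> is a root of the characteristic polynomial, so it
  is integral over \<open>R\<close>.
\<close>

lemma integrally_closed_matrix:
  fixes \<xi> u v :: "'a::idom fract"
  assumes ic: "integrally_closed TYPE('a)" and nz: "u \<noteq> 0 \<or> v \<noteq> 0"
    and eqs: "\<xi> * u = to_fract p * u + to_fract q * v" "\<xi> * v = to_fract r * u + to_fract s * v"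
  shows "\<xi> \<in> range to_fract"
proof -
  let ?D = "\<xi>^2 - to_fract (p + s) * \<xi> + to_fract (p * s - q * r)"
  have "?D * u = 0" "?D * v = 0"
    using eqs by (simp_all add: algebra_simps power2_eq_square) algebra+
  with nz have D: "?D = 0" by auto
  let ?f = "[:p * s - q * r, - (p + s), 1:]"
  have "map_poly to_fract ?f = [:to_fract (p * s - q * r), to_fract (- (p + s)), 1:]"
    by (simp add: map_poly_pCons)
  then have "poly (map_poly to_fract ?f) \<xi> = ?D"
    by (simp add: algebra_simps power2_eq_square)
  then have "lead_coeff ?f = 1 \<and> poly (map_poly to_fract ?f) \<xi> = 0"
    using D by simp
  then show ?thesis using ic unfolding integrally_closed_def by blast
qed

text \<open>
  With \<open>I\<close> generated by \<open>a\<close> and \<open>b\<close>, the steps below show \<open>I \<subseteq> cR\<close> and \<open>c \<in> I\<close>, so that \<open>c\<close> is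
  an element of \<open>R\<close> and a greatest common divisor of \<open>a\<close> and \<open>b\<close>.
\<close>

lemma boole_regular_imp_bezout:
  assumes ic: "integrally_closed TYPE('a::idom)" and boole: "boole_regular TYPE('a)"
  shows "bezout_domain TYPE('a)"
  unfolding bezout_domain_iff
proof (intro allI)
  fix a b :: 'a
  show "\<exists>d r s. d = r * a + s * b \<and> d dvd a \<and> d dvd b"
  proof (cases "a = 0 \<and> b = 0")
    case True
    then show ?thesis by (intro exI[of _ 0]) simp
  next
    case nz: False
    let ?A = "to_fract a" and ?B = "to_fract b"
    define I where "I = {to_fract r * ?A + to_fract s * ?B | r s. True}"
    have memI: "to_fract r * ?A + to_fract s * ?B \<in> I" for r s by (auto simp: I_def)
    have AI: "?A \<in> I" and BI: "?B \<in> I" using memI[of 1 0] memI[of 0 1] by simp_all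
    have sub: "module.subspace frac_scale I"
      unfolding frac_subspace_iff
    proof (intro conjI ballI allI)
      show "0 \<in> I" using memI[of 0 0] by simp
    next
      fix x y assume "x \<in> I" "y \<in> I"
      then obtain r s r' s' where "x = to_fract r * ?A + to_fract s * ?B"
        "y = to_fract r' * ?A + to_fract s' * ?B" by (auto simp: I_def)
      then show "x + y \<in> I" using memI[of "r + r'" "s + s'"] by (simp add: algebra_simps)
    next
      fix t x assume "x \<in> I"
      then obtain r s where "x = to_fract r * ?A + to_fract s * ?B" by (auto simp: I_def)
      then show "to_fract t * x \<in> I" using memI[of "t * r" "t * s"] by (simp add: algebra_simps)
    qed
    have "to_fract 1 * x \<in> range to_fract" if x: "x \<in> I" for x
    proof -
      obtain r s where "x = to_fract r * ?A + to_fract s * ?B" using x by (auto simp: I_def)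
      then have "to_fract 1 * x = to_fract (r * a + s * b)" by simp
      then show ?thesis by blast
    qed
    then have "fractional_ideal I"
      unfolding fractional_ideal_def using sub one_neq_zero by blast
    moreover have "I \<noteq> {0}" using nz AI BI by auto
    ultimately have "I \<in> nonzero_fractional_ideals" by (simp add: nonzero_fractional_ideals_def)
    then obtain c where c: "c \<noteq> 0" "\<And>x y. x \<in> I \<Longrightarrow> y \<in> I \<Longrightarrow> x * y / c \<in> I"
      "\<And>x. x \<in> I \<Longrightarrow> c * x \<in> frac_ideal_mult I I"
      using boole_regularE[OF boole] by blast
    \<comment> \<open>Multiplication by \<open>x / c\<close> maps \<open>I\<close> to itself, so it has a matrix over \<open>R\<close>.\<close>
    have int: "x / c \<in> range to_fract" if x: "x \<in> I" for x
    proof -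
      obtain p q where pq: "x * ?A / c = to_fract p * ?A + to_fract q * ?B"
        using c(2)[OF x AI] by (auto simp: I_def)
      obtain r s where rs: "x * ?B / c = to_fract r * ?A + to_fract s * ?B"
        using c(2)[OF x BI] by (auto simp: I_def)
      show ?thesis
        by (rule integrally_closed_matrix[OF ic, of ?A ?B _ p q r s])
          (use nz pq rs in auto)
    qed
    \<comment> \<open>\<open>I\<^sup>2 = Ia + Ib\<close>: after division by \<open>c\<close>, the generators of \<open>J\<close> are combinations of
      themselves with coefficients in \<open>J\<close>, not merely in \<open>R\<close>.\<close>
    have square: "frac_ideal_mult I I \<subseteq> {p * ?A + q * ?B | p q. p \<in> I \<and> q \<in> I}" (is "_ \<subseteq> ?L")
    proof (rule frac_ideal_mult_least)
      show "module.subspace frac_scale ?L"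
        unfolding frac_subspace_iff
      proof (intro conjI ballI allI)
        show "0 \<in> ?L" using sub by (auto simp: frac_subspace_iff intro!: exI[of _ 0])
      next
        fix x y assume "x \<in> ?L" "y \<in> ?L"
        then obtain p q p' q' where "x = p * ?A + q * ?B" "y = p' * ?A + q' * ?B"
          "p \<in> I" "q \<in> I" "p' \<in> I" "q' \<in> I" by auto
        then have "x + y = (p + p') * ?A + (q + q') * ?B" "p + p' \<in> I" "q + q' \<in> I"
          using sub by (auto simp: frac_subspace_iff algebra_simps)
        then show "x + y \<in> ?L" by blast
      next
        fix t x assume "x \<in> ?L"
        then obtain p q where "x = p * ?A + q * ?B" "p \<in> I" "q \<in> I" by auto
        then have "to_fract t * x = (to_fract t * p) * ?A + (to_fract t * q) * ?B"
          "to_fract t * p \<in> I" "to_fract t * q \<in> I"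
          using sub by (auto simp: frac_subspace_iff algebra_simps)
        then show "to_fract t * x \<in> ?L" by blast
      qed
    next
      fix x y assume x: "x \<in> I" and "y \<in> I"
      then obtain r s where "y = to_fract r * ?A + to_fract s * ?B" by (auto simp: I_def)
      then have "x * y = (to_fract r * x) * ?A + (to_fract s * x) * ?B"
        by (simp add: algebra_simps)
      moreover have "to_fract r * x \<in> I" "to_fract s * x \<in> I"
        using sub x by (auto simp: frac_subspace_iff)
      ultimately show "x * y \<in> ?L" by blast
    qed
    obtain p q where pq: "c * ?A = p * ?A + q * ?B" "p \<in> I" "q \<in> I"
      using c(3)[OF AI] square by blast
    obtain r s where rs: "c * ?B = r * ?A + s * ?B" "r \<in> I" "s \<in> I"
      using c(3)[OF BI] square by blast
    have "(c - p) * ?A = q * ?B" "(c - s) * ?B = r * ?A"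
      using pq(1) rs(1) by (simp_all add: algebra_simps)
    then have "((c - p) * (c - s) - q * r) * ?A = 0" "((c - p) * (c - s) - q * r) * ?B = 0"
      by algebra+
    \<comment> \<open>Divided by \<open>c\<close>, the expansion of this determinant expresses \<open>c\<close> through elements of \<open>I\<close>
      and of \<open>c\<^sup>-\<^sup>1I\<^sup>2 = I\<close>.\<close>
    then have "(c - p) * (c - s) - q * r = 0" using nz by auto
    then have "c * c = c * p + c * s - p * s + q * r" by (simp add: algebra_simps)
    also have "\<dots> = c * (p + s - p * s / c + q * r / c)"
      using c(1) by (simp add: distrib_left right_diff_distrib)
    finally have "c * c = c * (p + s - p * s / c + q * r / c)" .
    then have "c = p + s + (- 1) * (p * s / c) + q * r / c"
      using c(1) by simp
    also have "\<dots> \<in> I"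
    proof -
      have "to_fract (- 1) * (p * s / c) \<in> I"
        using sub c(2)[OF pq(2) rs(3)] unfolding frac_subspace_iff by blast
      then have "(- 1) * (p * s / c) \<in> I" by simp
      then show ?thesis
        using sub pq(2) rs(3) c(2)[OF pq(3) rs(2)] unfolding frac_subspace_iff by blast
    qed
    finally obtain t u where tu: "c = to_fract t * ?A + to_fract u * ?B"
      by (auto simp: I_def)
    define d where "d = t * a + u * b"
    have cd: "c = to_fract d" by (simp add: tu d_def)
    obtain a' b' where "?A / c = to_fract a'" "?B / c = to_fract b'"
      using int AI BI by blast
    then have "to_fract a = to_fract (d * a')" "to_fract b = to_fract (d * b')"
      using c(1) by (simp_all add: cd field_simps)
    then have "a = d * a'" "b = d * b'" by (simp_all only: to_fract_eq_iff)
    then have "d dvd a" "d dvd b" by simp_all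
    then show ?thesis using d_def by blast
  qed
qed

section \<open>Infinitely many comaximal divisors contradict Boole regularity\<close>

text \<open>
  The union of the ascending chain of cyclic modules \<open>R q\<^sub>n\<^sup>-\<^sup>1\<close>; the instances needed are
  \<open>q\<^sub>n = p\<^sub>n\<close> for the ideal \<open>I\<close> and \<open>q\<^sub>n = p\<^sub>n\<^sup>2\<close> for its square.
\<close>

lemma union_of_cyclic_subspace:
  fixes q :: "nat \<Rightarrow> 'a::idom"
  assumes dvd: "\<And>m n. m \<le> n \<Longrightarrow> q m dvd q n" and nz: "\<And>n. q n \<noteq> 0"
  shows "module.subspace frac_scale {to_fract r / to_fract (q n) | r n. True}" (is "module.subspace _ ?L")
  unfolding frac_subspace_iff
proof (intro conjI ballI allI)
  show "0 \<in> ?L" by (auto intro!: exI[of _ 0])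
next
  fix x y assume "x \<in> ?L" "y \<in> ?L"
  then obtain r m s n where xy: "x = to_fract r / to_fract (q m)" "y = to_fract s / to_fract (q n)"
    by auto
  obtain e f where ef: "q (max m n) = q m * e" "q (max m n) = q n * f"
    using dvd[of m "max m n"] dvd[of n "max m n"] by (auto simp: dvd_def)
  have "e \<noteq> 0" "f \<noteq> 0" using ef nz[of "max m n"] by auto
  then have "x = to_fract (r * e) / to_fract (q (max m n))" "y = to_fract (s * f) / to_fract (q (max m n))"
    using nz by (simp add: xy ef(1), simp add: xy ef(2))
  then have "x + y = to_fract (r * e + s * f) / to_fract (q (max m n))"
    by (simp add: add_divide_distrib)
  then show "x + y \<in> ?L" by blast
next
  fix t x assume "x \<in> ?L"
  then obtain r m where "x = to_fract r / to_fract (q m)" by auto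
  then have "to_fract t * x = to_fract (t * r) / to_fract (q m)" by simp
  then show "to_fract t * x \<in> ?L" by blast
qed

text \<open>
  Here \<open>I\<close> is the union of the chain \<open>R p\<^sub>n\<^sup>-\<^sup>1\<close>, and \<open>J = c\<^sup>-\<^sup>1I\<close> is the union of the chain \<open>R y\<^sub>n\<close>
  with \<open>y\<^sub>n = (c p\<^sub>n)\<^sup>-\<^sup>1\<close>. The inclusion \<open>J\<^sup>2 \<subseteq> J\<close> says that a block product
  \<open>q n k = b\<^sub>n \<cdots> b\<^sub>k\<^sub>-\<^sub>1\<close> is a denominator for \<open>y\<^sub>n\<close>. Repeating this from \<open>k\<close> on yields a second,
  comaximal denominator, so \<open>y\<^sub>n \<in> R\<close>. The inclusion \<open>J \<subseteq> J\<^sup>2\<close> says that \<open>y\<^sub>n\<close> divides the square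
  of a block product, and again two comaximal blocks show that some \<open>y\<^sub>k\<close> is a unit. But
  \<open>y\<^sub>k = y\<^sub>k\<^sub>+\<^sub>1 b\<^sub>k\<close>, so \<open>b\<^sub>k\<close> would be a unit.
\<close>

lemma boole_regular_no_comaximal_sequence:
  fixes b :: "nat \<Rightarrow> 'a::idom"
  assumes boole: "boole_regular TYPE('a)" and x: "x \<noteq> 0"
    and b: "\<And>i. b i dvd x" "\<And>i. \<not> b i dvd 1" and comax: "\<And>i j. i < j \<Longrightarrow> comaximal (b i) (b j)"
  shows False
proof -
  define q where "q m n = prod b {m..<n}" for m n
  define p where "p n = q 0 n" for n
  have p_mult: "p n = p m * q m n" if "m \<le> n" for m n
    using that by (simp add: p_def q_def prod.atLeastLessThan_concat)
  have q_comax: "comaximal (q k m) (q m n)" for k m n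
    unfolding q_def using comax
    by (intro comaximal_prod_right)
       (subst comaximal_commute, auto intro!: comaximal_prod_right intro: comaximal_commute[THEN iffD1])
  have p_dvd: "p n dvd x" for n
  proof (induction n)
    case (Suc n)
    have "comaximal (p n) (q n (Suc n))" unfolding p_def by (rule q_comax)
    with Suc b(1)[of n] show ?case
      using p_mult[of n "Suc n"] by (simp add: q_def comaximal_mult_dvd)
  qed (simp add: p_def q_def)
  have p_nz: "p n \<noteq> 0" for n using p_dvd[of n] x by auto
  have p_mono: "p m dvd p n" if "m \<le> n" for m n using p_mult[OF that] by simp

  define I where "I = {to_fract r / to_fract (p n) | r n. True}"
  have sub: "module.subspace frac_scale I"
    unfolding I_def by (rule union_of_cyclic_subspace) (use p_mono p_nz in auto)
  have pI: "1 / to_fract (p n) \<in> I" for n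
    unfolding I_def by (auto intro!: exI[of _ 1] exI[of _ n])
  have "to_fract x * z \<in> range to_fract" if zI: "z \<in> I" for z
  proof -
    obtain r n where z: "z = to_fract r / to_fract (p n)" using zI by (auto simp: I_def)
    obtain y where "x = p n * y" using p_dvd[of n] by (auto simp: dvd_def)
    then have "to_fract x * z = to_fract (r * y)" using p_nz[of n] by (simp add: z)
    then show ?thesis by blast
  qed
  then have "fractional_ideal I" unfolding fractional_ideal_def using sub x by blast
  moreover have "I \<noteq> {0}" using pI[of 0] p_nz[of 0] by auto
  ultimately have "I \<in> nonzero_fractional_ideals" by (simp add: nonzero_fractional_ideals_def)
  then obtain c where c: "c \<noteq> 0" "\<And>x y. x \<in> I \<Longrightarrow> y \<in> I \<Longrightarrow> x * y / c \<in> I"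
    "\<And>x. x \<in> I \<Longrightarrow> c * x \<in> frac_ideal_mult I I"
    using boole_regularE[OF boole] by blast
  have square: "frac_ideal_mult I I \<subseteq> {to_fract r / to_fract ((p n)\<^sup>2) | r n. True}" (is "_ \<subseteq> ?L")
  proof (rule frac_ideal_mult_least)
    show "module.subspace frac_scale ?L"
      by (rule union_of_cyclic_subspace) (use p_mono p_nz in \<open>auto intro: dvd_power_same\<close>)
  next
    fix y z assume "y \<in> I" "z \<in> I"
    then obtain r m s n where yz: "y = to_fract r / to_fract (p m)" "z = to_fract s / to_fract (p n)"
      by (auto simp: I_def)
    let ?k = "max m n"
    obtain e f where ef: "p ?k = p m * e" "p ?k = p n * f"
      using p_mono[of m ?k] p_mono[of n ?k] by (auto simp: dvd_def)
    have "e \<noteq> 0" "f \<noteq> 0" using ef p_nz[of ?k] by auto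
    then have "y = to_fract (r * e) / to_fract (p ?k)" "z = to_fract (s * f) / to_fract (p ?k)"
      using p_nz by (simp add: yz ef(1), simp add: yz ef(2))
    then have "y * z = to_fract ((r * e) * (s * f)) / to_fract ((p ?k)\<^sup>2)"
      by (simp add: power2_eq_square)
    then show "y * z \<in> ?L" by blast
  qed

  \<comment> \<open>From \<open>J\<^sup>2 \<subseteq> J\<close>: the product \<open>q n k\<close> times \<open>y\<^sub>n\<close> is the ring element \<open>r\<close>.\<close>
  have denom: "\<exists>k\<ge>n. \<exists>r. to_fract (q n k) = c * to_fract (p n) * to_fract r" for n
  proof -
    obtain r j where rj: "1 / to_fract (p n) * (1 / to_fract (p n)) / c = to_fract r / to_fract (p j)"
      using c(2)[OF pI pI, of n n] by (auto simp: I_def)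
    let ?k = "max n j"
    have "to_fract (p j) = c * to_fract (p n) * to_fract (p n) * to_fract r"
      using rj c(1) p_nz[of n] p_nz[of j] by (simp add: field_simps)
    moreover have "to_fract (p n) * to_fract (q n ?k) = to_fract (p j) * to_fract (q j ?k)"
      using p_mult[of n ?k] p_mult[of j ?k] by (simp flip: to_fract_mult)
    ultimately have "to_fract (p n) * to_fract (q n ?k)
        = to_fract (p n) * (c * to_fract (p n) * to_fract (r * q j ?k))"
      by (simp add: algebra_simps)
    then have "to_fract (q n ?k) = c * to_fract (p n) * to_fract (r * q j ?k)"
      using p_nz[of n] by simp
    then show ?thesis by (meson max.cobounded1)
  qed
  \<comment> \<open>From \<open>J \<subseteq> J\<^sup>2\<close>: the quotient of the square of \<open>q n k\<close> by \<open>y\<^sub>n\<close> is the ring element \<open>s\<close>.\<close>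
  have num: "\<exists>k s. c * to_fract (p n) * to_fract ((q n k)\<^sup>2) = to_fract s" for n
  proof -
    obtain s j where sj: "c * (1 / to_fract (p n)) = to_fract s / to_fract ((p j)\<^sup>2)"
      using c(3)[OF pI] square by blast
    let ?k = "max n j"
    have "c * to_fract (p j) * to_fract (p j) = to_fract s * to_fract (p n)"
      using sj p_nz[of n] p_nz[of j] by (simp add: field_simps power2_eq_square)
    moreover have "to_fract (p n) * to_fract (q n ?k) = to_fract (p j) * to_fract (q j ?k)"
      using p_mult[of n ?k] p_mult[of j ?k] by (simp flip: to_fract_mult)
    ultimately have "to_fract (p n) * (c * to_fract (p n) * to_fract ((q n ?k)\<^sup>2))
        = to_fract (p n) * to_fract (s * (q j ?k)\<^sup>2)"
      unfolding power2_eq_square to_fract_mult by algebra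
    then have "c * to_fract (p n) * to_fract ((q n ?k)\<^sup>2) = to_fract (s * (q j ?k)\<^sup>2)"
      using p_nz[of n] by simp
    then show ?thesis by blast
  qed

  have "\<exists>y. c * to_fract (p n) * to_fract y = 1" for n
  proof -
    obtain k r where k: "n \<le> k" "to_fract (q n k) = c * to_fract (p n) * to_fract r"
      using denom by blast
    obtain l s where l: "k \<le> l" "to_fract (q k l) = c * to_fract (p k) * to_fract s"
      using denom by blast
    obtain u v where uv: "u * q n k + v * q k l = 1"
      using q_comax[of n k l] by (auto simp: comaximal_def)
    have "1 = to_fract u * to_fract (q n k) + to_fract v * to_fract (q k l)"
      using arg_cong[OF uv, of to_fract] by simp
    also have "\<dots> = c * to_fract (p n) * to_fract (u * r + v * q n k * s)"
      unfolding l(2) p_mult[OF k(1)] by (simp add: k(2) algebra_simps)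
    finally show ?thesis by metis
  qed
  then obtain y where y: "\<And>n. c * to_fract (p n) * to_fract (y n) = 1" by metis
  have y_mult: "y m = y n * q m n" if "m \<le> n" for m n
  proof -
    have "c * to_fract (p m) * to_fract (y m) = c * to_fract (p m) * to_fract (y n * q m n)"
      using y[of m] y[of n] p_mult[OF that] by (simp add: mult_ac)
    then have "to_fract (y m) = to_fract (y n * q m n)" using c(1) p_nz[of m] by simp
    then show ?thesis by (simp only: to_fract_eq_iff)
  qed
  have y_dvd: "\<exists>k. y n dvd (q n k)\<^sup>2" for n
  proof -
    obtain k s where k: "c * to_fract (p n) * to_fract ((q n k)\<^sup>2) = to_fract s"
      using num by blast
    have "to_fract ((q n k)\<^sup>2) = (c * to_fract (p n) * to_fract (y n)) * to_fract ((q n k)\<^sup>2)"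
      by (simp add: y)
    also have "\<dots> = to_fract (y n) * (c * to_fract (p n) * to_fract ((q n k)\<^sup>2))"
      by (simp only: mult_ac)
    also have "\<dots> = to_fract (y n * s)" by (simp only: k to_fract_mult)
    finally have "(q n k)\<^sup>2 = y n * s" by (simp only: to_fract_eq_iff)
    then show ?thesis by (intro exI[of _ k] dvdI)
  qed
  obtain k where k: "y 0 dvd (q 0 k)\<^sup>2" using y_dvd by blast
  obtain l where l: "y k dvd (q k l)\<^sup>2" using y_dvd by blast
  have "y k dvd (q 0 k)\<^sup>2" using k y_mult[of 0 k] by (auto intro: dvd_trans[OF dvd_triv_left])
  moreover have "comaximal ((q 0 k)\<^sup>2) ((q k l)\<^sup>2)"
    unfolding power2_eq_square
    by (meson q_comax comaximal_commute comaximal_mult_right)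
  ultimately have "y k dvd 1" using comaximal_common_divisor l by blast
  moreover have "b k dvd y k" using y_mult[of k "Suc k"] by (simp add: q_def)
  ultimately show False using b(2) dvd_trans by blast
qed

theorem corollary2p4:
  assumes "integrally_closed TYPE('a::idom)"
    and "boole_regular TYPE('a)"
  shows "bezout_domain TYPE('a) \<and> finite_character TYPE('a)"
proof
  show bez: "bezout_domain TYPE('a)" by (rule boole_regular_imp_bezout[OF assms])
  show "finite_character TYPE('a)"
    unfolding finite_character_def
  proof (intro allI impI)
    fix I :: "'a set" assume I: "is_ideal I" "I \<noteq> {0}" "I \<noteq> UNIV"
    then obtain x where x: "x \<in> I" "x \<noteq> 0" by (auto simp: is_ideal_iff)
    have "finite {M. is_maximal_ideal M \<and> x \<in> M}"
    proof (rule ccontr)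
      assume "infinite {M. is_maximal_ideal M \<and> x \<in> M}"
      from comaximal_sequence_of_divisors[OF bez this] show False
        using boole_regular_no_comaximal_sequence[OF assms(2) x(2)] by blast
    qed
    moreover have "{M. is_maximal_ideal M \<and> I \<subseteq> M} \<subseteq> {M. is_maximal_ideal M \<and> x \<in> M}"
      using x(1) by blast
    ultimately show "finite {M. is_maximal_ideal M \<and> I \<subseteq> M}" by (rule rev_finite_subset)
  qed
qed

end
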